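(* Let $Z=QUWX_1X_2X_sY_pY_s\in\mathcal{P}^*$ and $i\in\{1,2\}$. Then $\mathcal{R}^o(Z)\subseteq\mathcal{R}_i^r(Z)$ if and only if $$I(Y_p;X_i|WQ)\le I(Y_s;X_i|UWQ).$$
   Context: $\mathcal{X}_1,\mathcal{X}_2,\mathcal{X}_s,\mathcal{Y}_p,\mathcal{Y}_s$ are finite sets and $\omega(y_py_s|x_1x_2x_s)$ is a channel (conditional probability distribution) from $\mathcal{X}_1\times\mathcal{X}_2\times\mathcal{X}_s$ to $\mathcal{Y}_p\times\mathcal{Y}_s$. $\mathcal{P}^*$ is the set of all tuples of random variables $Z=QUWX_1X_2X_sY_pY_s$, with $Q,U,W$ taking values in some finite sets and $X_a\in\mathcal{X}_a$, $Y_b\in\mathcal{Y}_b$, such that: $X_1,X_2,U,W$ are conditionally independent given $Q$; $X_s=f(UW|Q)$, i.e. $X_s$ is a deterministic function of $(U,W)$ for each value of $Q$; and given $(Q,U,W,X_1,X_2,X_s)$ the pair $(Y_p,Y_s)$ has conditional law $\omega(\cdot|X_1X_2X_s)$. For a tuple $(R_1,R_2,S,T)$ of nonnegative reals consider the primary-receiver constraints $$(P)\quad\begin{aligned}&R_1\le I(Y_p;X_1|WX_2Q),\ R_2\le I(Y_p;X_2|WX_1Q),\ T\le I(Y_p;W|X_1X_2Q),\\&R_1+R_2\le I(Y_p;X_1X_2|WQ),\ R_1+T\le I(Y_p;WX_1|X_2Q),\ R_2+T\le I(Y_p;WX_2|X_1Q),\\&R_1+R_2+T\le I(Y_p;WX_1X_2|Q).\end{aligned}$$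 $\delta^o(Z)$ is the set of nonnegative tuples $(R_1,R_2,S,T)$ satisfying (P) and $$S\le I(Y_s;U|WQ),\quad T\le I(Y_s;W|UQ),\quad S+T\le I(Y_s;UW|Q).$$ For $i\in\{1,2\}$, $\delta_i^r(Z)$ is the set of nonnegative tuples $(R_1,R_2,S,T)$ satisfying (P) and $$S\le I(Y_s;U|WX_iQ),\quad T\le I(Y_s;W|UX_iQ),\quad R_i\le I(Y_s;X_i|UWQ),\quad S+T\le I(Y_s;UW|X_iQ),$$ $$R_i+S\le I(Y_s;UX_i|WQ),\quad R_i+T\le I(Y_s;WX_i|UQ),\quad R_i+S+T\le I(Y_s;UWX_i|Q).$$ $\mathcal{R}^o(Z)$ (respectively $\mathcal{R}_i^r(Z)$) is the set of all pairs $(R_s,R_p)=(S+T,\,R_1+R_2)$ with $(R_1,R_2,S,T)\in\delta^o(Z)$ (respectively $\delta_i^r(Z)$). *)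

theory Defs
  imports "HOL-Probability.Probability"
begin

text \<open>
  The joint variable of two random variables; a string such as \<open>W X\<^sub>2 Q\<close> is the nested
  joint variable \<open>W \<bowtie> X\<^sub>2 \<bowtie> Q\<close>.
\<close>

abbreviation joint_rv :: "('a \<Rightarrow> 'b) \<Rightarrow> ('a \<Rightarrow> 'c) \<Rightarrow> 'a \<Rightarrow> 'b \<times> 'c"  (infixr \<open>\<bowtie>\<close> 90)
  where "X \<bowtie> Y \<equiv> (\<lambda>x. (X x, Y x))"

text \<open>
  The library's \<open>\<I>(X ; Y | Z)\<close> for finite-valued random variables, with the probability
  space \<open>M\<close> and the base \<open>b\<close> of the logarithm explicit so that it can be used outside
  the locale \<open>information_space\<close>.
\<close>

abbreviation cmi ::
    "'a measure \<Rightarrow> real \<Rightarrow> ('a \<Rightarrow> 'b) \<Rightarrow> ('a \<Rightarrow> 'c) \<Rightarrow> ('a \<Rightarrow> 'd) \<Rightarrow> real"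
  where "cmi M b X Y Z \<equiv> prob_space.conditional_mutual_information M b
     (count_space (X ` space M)) (count_space (Y ` space M)) (count_space (Z ` space M)) X Y Z"

record ('a, 'q, 'u, 'w, 'x1, 'x2, 'xs, 'yp, 'ys) rv_tuple =
  rvQ  :: "'a \<Rightarrow> 'q"
  rvU  :: "'a \<Rightarrow> 'u"
  rvW  :: "'a \<Rightarrow> 'w"
  rvX1 :: "'a \<Rightarrow> 'x1"
  rvX2 :: "'a \<Rightarrow> 'x2"
  rvXs :: "'a \<Rightarrow> 'xs"
  rvYp :: "'a \<Rightarrow> 'yp"
  rvYs :: "'a \<Rightarrow> 'ys"

text \<open>
  Only the values of \<open>\<omega>\<close> on the input alphabets matter; there it must be a distribution on
  the product of the output alphabets.
\<close>

definition channel ::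
    "'x1 set \<Rightarrow> 'x2 set \<Rightarrow> 'xs set \<Rightarrow> 'yp set \<Rightarrow> 'ys set
      \<Rightarrow> ('x1 \<Rightarrow> 'x2 \<Rightarrow> 'xs \<Rightarrow> ('yp \<times> 'ys) pmf) \<Rightarrow> bool"
  where "channel \<X>1 \<X>2 \<X>s \<Y>p \<Y>s \<omega> \<longleftrightarrow>
    (\<forall>x1\<in>\<X>1. \<forall>x2\<in>\<X>2. \<forall>xs\<in>\<X>s. set_pmf (\<omega> x1 x2 xs) \<subseteq> \<Y>p \<times> \<Y>s)"

definition cond_indep4 ::
    "'a measure \<Rightarrow> ('a \<Rightarrow> 'b) \<Rightarrow> ('a \<Rightarrow> 'c) \<Rightarrow> ('a \<Rightarrow> 'd) \<Rightarrow> ('a \<Rightarrow> 'e) \<Rightarrow> ('a \<Rightarrow> 'q) \<Rightarrow> bool"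
  where "cond_indep4 M A B C D Q \<longleftrightarrow>
    (\<forall>q a b c d. \<P>(x in M. Q x = q) > 0 \<longrightarrow>
      \<P>(x in M. A x = a \<and> B x = b \<and> C x = c \<and> D x = d \<bar> Q x = q) =
      \<P>(x in M. A x = a \<bar> Q x = q) * \<P>(x in M. B x = b \<bar> Q x = q) *
      \<P>(x in M. C x = c \<bar> Q x = q) * \<P>(x in M. D x = d \<bar> Q x = q))"

text \<open>
  The set \<open>\<P>\<^sup>*\<close> of admissible tuples on the probability space \<open>M\<close>. A
  \<open>simple_function\<close> is exactly a random variable with finite range.
\<close>

definition Pstar ::
    "'a measure \<Rightarrow> 'x1 set \<Rightarrow> 'x2 set \<Rightarrow> 'xs set \<Rightarrow> 'yp set \<Rightarrow> 'ys set
      \<Rightarrow> ('x1 \<Rightarrow> 'x2 \<Rightarrow> 'xs \<Rightarrow> ('yp \<times> 'ys) pmf)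
      \<Rightarrow> ('a, 'q, 'u, 'w, 'x1, 'x2, 'xs, 'yp, 'ys) rv_tuple set"
  where "Pstar M \<X>1 \<X>2 \<X>s \<Y>p \<Y>s \<omega> = {Z.
    simple_function M (rvQ Z) \<and> simple_function M (rvU Z) \<and> simple_function M (rvW Z) \<and>
    simple_function M (rvX1 Z) \<and> rvX1 Z \<in> space M \<rightarrow> \<X>1 \<and>
    simple_function M (rvX2 Z) \<and> rvX2 Z \<in> space M \<rightarrow> \<X>2 \<and>
    simple_function M (rvXs Z) \<and> rvXs Z \<in> space M \<rightarrow> \<X>s \<and>
    simple_function M (rvYp Z) \<and> rvYp Z \<in> space M \<rightarrow> \<Y>p \<and>
    simple_function M (rvYs Z) \<and> rvYs Z \<in> space M \<rightarrow> \<Y>s \<and>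
    cond_indep4 M (rvX1 Z) (rvX2 Z) (rvU Z) (rvW Z) (rvQ Z) \<and>
    (\<exists>f. AE x in M. rvXs Z x = f (rvQ Z x) (rvU Z x) (rvW Z x)) \<and>
    (\<forall>q u w x1 x2 xs yp ys.
      \<P>(x in M. rvQ Z x = q \<and> rvU Z x = u \<and> rvW Z x = w \<and>
        rvX1 Z x = x1 \<and> rvX2 Z x = x2 \<and> rvXs Z x = xs) > 0 \<longrightarrow>
      \<P>(x in M. rvYp Z x = yp \<and> rvYs Z x = ys \<bar>
        rvQ Z x = q \<and> rvU Z x = u \<and> rvW Z x = w \<and>
        rvX1 Z x = x1 \<and> rvX2 Z x = x2 \<and> rvXs Z x = xs) = pmf (\<omega> x1 x2 xs) (yp, ys))}"

definition primary_constraints ::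
    "'a measure \<Rightarrow> real \<Rightarrow> ('a, 'q, 'u, 'w, 'x1, 'x2, 'xs, 'yp, 'ys) rv_tuple
      \<Rightarrow> real \<Rightarrow> real \<Rightarrow> real \<Rightarrow> bool"
  where "primary_constraints M b Z R1 R2 T \<longleftrightarrow>
    (let Q = rvQ Z; W = rvW Z; X1 = rvX1 Z; X2 = rvX2 Z; Yp = rvYp Z in
      R1 \<le> cmi M b Yp X1 (W \<bowtie> X2 \<bowtie> Q) \<and>
      R2 \<le> cmi M b Yp X2 (W \<bowtie> X1 \<bowtie> Q) \<and>
      T \<le> cmi M b Yp W (X1 \<bowtie> X2 \<bowtie> Q) \<and>
      R1 + R2 \<le> cmi M b Yp (X1 \<bowtie> X2) (W \<bowtie> Q) \<and>
      R1 + T \<le> cmi M b Yp (W \<bowtie> X1) (X2 \<bowtie> Q) \<and>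
      R2 + T \<le> cmi M b Yp (W \<bowtie> X2) (X1 \<bowtie> Q) \<and>
      R1 + R2 + T \<le> cmi M b Yp (W \<bowtie> X1 \<bowtie> X2) Q)"

definition delta_o ::
    "'a measure \<Rightarrow> real \<Rightarrow> ('a, 'q, 'u, 'w, 'x1, 'x2, 'xs, 'yp, 'ys) rv_tuple
      \<Rightarrow> (real \<times> real \<times> real \<times> real) set"
  where "delta_o M b Z = {(R1, R2, S, T).
    0 \<le> R1 \<and> 0 \<le> R2 \<and> 0 \<le> S \<and> 0 \<le> T \<and> primary_constraints M b Z R1 R2 T \<and>
    (let Q = rvQ Z; U = rvU Z; W = rvW Z; Ys = rvYs Z in
      S \<le> cmi M b Ys U (W \<bowtie> Q) \<and>
      T \<le> cmi M b Ys W (U \<bowtie> Q) \<and>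
      S + T \<le> cmi M b Ys (U \<bowtie> W) Q)}"

text \<open>
  The constraints on the secondary receiver when it also decodes the message of the primary
  sender with input \<open>Xi\<close> and rate \<open>Ri\<close>. The input is an argument because \<open>X\<^sub>1\<close> and \<open>X\<^sub>2\<close>
  may have different types.
\<close>

definition secondary_constraints_r ::
    "'a measure \<Rightarrow> real \<Rightarrow> ('a, 'q, 'u, 'w, 'x1, 'x2, 'xs, 'yp, 'ys) rv_tuple
      \<Rightarrow> ('a \<Rightarrow> 'xi) \<Rightarrow> real \<Rightarrow> real \<Rightarrow> real \<Rightarrow> bool"
  where "secondary_constraints_r M b Z Xi Ri S T \<longleftrightarrow>
    (let Q = rvQ Z; U = rvU Z; W = rvW Z; Ys = rvYs Z in
      S \<le> cmi M b Ys U (W \<bowtie> Xi \<bowtie> Q) \<and>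
      T \<le> cmi M b Ys W (U \<bowtie> Xi \<bowtie> Q) \<and>
      Ri \<le> cmi M b Ys Xi (U \<bowtie> W \<bowtie> Q) \<and>
      S + T \<le> cmi M b Ys (U \<bowtie> W) (Xi \<bowtie> Q) \<and>
      Ri + S \<le> cmi M b Ys (U \<bowtie> Xi) (W \<bowtie> Q) \<and>
      Ri + T \<le> cmi M b Ys (W \<bowtie> Xi) (U \<bowtie> Q) \<and>
      Ri + S + T \<le> cmi M b Ys (U \<bowtie> W \<bowtie> Xi) Q)"

definition delta_r ::
    "'a measure \<Rightarrow> real \<Rightarrow> nat \<Rightarrow> ('a, 'q, 'u, 'w, 'x1, 'x2, 'xs, 'yp, 'ys) rv_tuple
      \<Rightarrow> (real \<times> real \<times> real \<times> real) set"
  where "delta_r M b i Z = {(R1, R2, S, T).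
    0 \<le> R1 \<and> 0 \<le> R2 \<and> 0 \<le> S \<and> 0 \<le> T \<and> primary_constraints M b Z R1 R2 T \<and>
    (if i = 1 then secondary_constraints_r M b Z (rvX1 Z) R1 S T
     else secondary_constraints_r M b Z (rvX2 Z) R2 S T)}"

definition rate_pairs :: "(real \<times> real \<times> real \<times> real) set \<Rightarrow> (real \<times> real) set"
  where "rate_pairs D = {(S + T, R1 + R2) | R1 R2 S T. (R1, R2, S, T) \<in> D}"

definition region_o ::
    "'a measure \<Rightarrow> real \<Rightarrow> ('a, 'q, 'u, 'w, 'x1, 'x2, 'xs, 'yp, 'ys) rv_tuple
      \<Rightarrow> (real \<times> real) set"
  where "region_o M b Z = rate_pairs (delta_o M b Z)"

definition region_r ::
    "'a measure \<Rightarrow> real \<Rightarrow> nat \<Rightarrow> ('a, 'q, 'u, 'w, 'x1, 'x2, 'xs, 'yp, 'ys) rv_tuple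
      \<Rightarrow> (real \<times> real) set"
  where "region_r M b i Z = rate_pairs (delta_r M b i Z)"

end

theory Submission
  imports Defs
begin

text \<open>Take i = 1; exchanging the primary senders then gives i = 2. A projected pair fixes only
  S + T and R1 + R2, so rate may be moved between the two primary messages. Since X1 is independent
  of (X2, U, W) given Q, adding X1 to the conditioning never lowers what Ys tells about U, W or
  both, so the \<open>delta_o\<close> bounds on S and T imply those of \<open>delta_r\<close>. By
  the chain rule, every further bound of the secondary receiver that involves R1 is I(Ys;X1|UWQ)
  plus a bound of \<open>delta_o\<close>. What remains is R1 <= I(Ys;X1|UWQ). The primary bounds
  always let R1 be cut to I(Yp;X1|WQ), with the excess given to R2, and a corner point with T = 0
  and R2 maximal shows that R1 cannot always go lower. Comparing the two values gives the criterion,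
  in \<open>region_o_subset_region_r_1_iff\<close>.

  The information inequalities rest on the four-entropy formula
  \<open>cond_mutual_info_eq_entropy\<close>, which yields the chain rules and
  \<open>cond_mutual_info_mono_indep\<close>. The factorisation in \<open>Pstar\<close> enters
  through \<open>cond_indep4_imp_cond_mutual_info_eq_0\<close>.\<close>

lemma rate_pairsI: "(R1, R2, S, T) \<in> D \<Longrightarrow> (S + T, R1 + R2) \<in> rate_pairs D"
  by (auto simp: rate_pairs_def)

lemma rate_pairs_swap_mono:
  assumes "\<And>R1 R2 S T. (R1, R2, S, T) \<in> D \<Longrightarrow> (R2, R1, S, T) \<in> D'"
  shows "rate_pairs D \<subseteq> rate_pairs D'"
proof
  fix p assume "p \<in> rate_pairs D"
  then obtain R1 R2 S T where p: "p = (S + T, R1 + R2)" and "(R1, R2, S, T) \<in> D"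
    by (auto simp: rate_pairs_def)
  from rate_pairsI[OF assms[OF this(2)]] show "p \<in> rate_pairs D'"
    by (simp add: p add.commute)
qed

lemma cond_indep4_swap:
  assumes "cond_indep4 M A B C D Q"
  shows "cond_indep4 M B A C D Q"
proof -
  have eq: "(\<lambda>x. B x = y \<and> A x = a \<and> C x = c \<and> D x = d) =
    (\<lambda>x. A x = a \<and> B x = y \<and> C x = c \<and> D x = d)" for a y c d
    by auto
  show ?thesis
    unfolding cond_indep4_def eq using assms
    by (simp add: cond_indep4_def mult.commute)
qed

section \<open>Entropy and conditional mutual information as expectations\<close>

definition (in prob_space) law :: "('a \<Rightarrow> 'b) \<Rightarrow> 'b \<Rightarrow> real"
  where "law X v = prob (X -` {v} \<inter> space M)"

context information_space
begin

lemma simple_distributed_law: "simple_function M X \<Longrightarrow> simple_distributed M X (law X)"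
  by (rule simple_distributedI) (auto simp: law_def)

text \<open>Turns sums over the ranges of different joint variables into integrals over the one
  space \<open>M\<close>, where they can be compared pointwise almost everywhere.\<close>

lemma sum_law_eq_expectation:
  assumes "simple_function M X"
  shows "(\<Sum>v\<in>X ` space M. law X v * g v) = expectation (\<lambda>x. g (X x))"
proof -
  have "(\<integral>v. law X v * g v \<partial>count_space (X ` space M)) = expectation (\<lambda>x. g (X x))"
    by (rule distributed_integral[OF simple_distributed[OF simple_distributed_law[OF assms]]])
      (auto simp: law_def)
  then show ?thesis
    using assms by (simp add: lebesgue_integral_count_space_finite simple_functionD)
qed

lemma integrable_simple_comp:
  fixes g :: "'b \<Rightarrow> real"
  assumes "simple_function M X"
  shows "integrable M (\<lambda>x. g (X x))"
proof (rule integrable_const_bound)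
  show "AE x in M. norm (g (X x)) \<le> Max ((\<lambda>v. \<bar>g v\<bar>) ` X ` space M)"
    using assms by (intro AE_I2) (auto simp: simple_functionD)
  show "(\<lambda>x. g (X x)) \<in> borel_measurable M"
    using simple_function_compose[OF assms, of g]
    by (intro borel_measurable_simple_function) (simp add: comp_def)
qed

text \<open>The range is finite, so the values of mass 0 are hit only on a finite union of null
  sets. This licenses splitting logarithms of quotients under the integral.\<close>

lemma AE_law_pos:
  assumes "simple_function M X"
  shows "AE x in M. 0 < law X (X x)"
proof -
  have "AE x in M. \<forall>v\<in>{v \<in> X ` space M. law X v = 0}. X x \<noteq> v"
  proof (rule AE_finite_allI)
    show "finite {v \<in> X ` space M. law X v = 0}"
      using assms by (simp add: simple_functionD)
    fix v assume "v \<in> {v \<in> X ` space M. law X v = 0}"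
    then have "X -` {v} \<inter> space M \<in> null_sets M"
      using assms by (auto simp: law_def null_sets_def emeasure_eq_measure simple_functionD)
    then show "AE x in M. X x \<noteq> v"
      by (rule AE_I') auto
  qed
  then show ?thesis
    using AE_space
  proof eventually_elim
    case (elim x)
    then have "law X (X x) \<noteq> 0" by auto
    then show ?case by (auto simp: law_def less_le)
  qed
qed

lemma entropy_eq_expectation:
  assumes "simple_function M X"
  shows "\<H>(X) = - expectation (\<lambda>x. log b (law X (X x)))"
  by (simp add: entropy_simple_distributed[OF simple_distributed_law[OF assms]]
      sum_law_eq_expectation[OF assms, of "\<lambda>v. log b (law X v)"])

text \<open>Entropy sees only the partition of the space into fibres, not the labels. This absorbs
  every reordering and rebracketing of nested joint variables.\<close>

lemma entropy_cong_kernel: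
  assumes "simple_function M X" "simple_function M X'"
    and "\<And>x y. x \<in> space M \<Longrightarrow> y \<in> space M \<Longrightarrow> X x = X y \<longleftrightarrow> X' x = X' y"
  shows "\<H>(X) = \<H>(X')"
proof -
  have "X -` {X x} \<inter> space M = X' -` {X' x} \<inter> space M" if "x \<in> space M" for x
    using assms(3)[OF _ that] by auto
  then have "expectation (\<lambda>x. log b (law X (X x))) = expectation (\<lambda>x. log b (law X' (X' x)))"
    by (intro Bochner_Integration.integral_cong) (auto simp: law_def)
  then show ?thesis
    by (simp add: entropy_eq_expectation assms)
qed

lemma cond_mutual_info_eq_expectation:
  assumes X: "simple_function M X" and Y: "simple_function M Y" and Z: "simple_function M Z"
  shows "\<I>(X ; Y | Z) = expectation (\<lambda>x. log b (law (X \<bowtie> Y \<bowtie> Z) (X x, Y x, Z x) /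
    (law (X \<bowtie> Z) (X x, Z x) * (law (Y \<bowtie> Z) (Y x, Z x) / law Z (Z x)))))"
proof -
  have "\<I>(X ; Y | Z) = (\<Sum>v\<in>(X \<bowtie> Y \<bowtie> Z) ` space M. law (X \<bowtie> Y \<bowtie> Z) v *
      (\<lambda>(x, y, z). log b (law (X \<bowtie> Y \<bowtie> Z) (x, y, z) /
        (law (X \<bowtie> Z) (x, z) * (law (Y \<bowtie> Z) (y, z) / law Z z)))) v)"
    by (subst conditional_mutual_information_eq[OF simple_distributed_law simple_distributed_law
          simple_distributed_law simple_distributed_law])
      (auto intro!: sum.cong X Y Z simple_function_Pair)
  also have "\<dots> = expectation (\<lambda>x. log b (law (X \<bowtie> Y \<bowtie> Z) (X x, Y x, Z x) /
    (law (X \<bowtie> Z) (X x, Z x) * (law (Y \<bowtie> Z) (Y x, Z x) / law Z (Z x)))))"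
    by (subst sum_law_eq_expectation) (auto intro!: X Y Z simple_function_Pair)
  finally show ?thesis .
qed

text \<open>Reduces identities between informations to linear arithmetic over entropies.\<close>

lemma cond_mutual_info_eq_entropy:
  assumes X: "simple_function M X" and Y: "simple_function M Y" and Z: "simple_function M Z"
  shows "\<I>(X ; Y | Z) = \<H>(X \<bowtie> Z) + \<H>(Y \<bowtie> Z) - \<H>(X \<bowtie> Y \<bowtie> Z) - \<H>(Z)"
proof -
  note sf = X Y Z simple_function_Pair
  let ?l = "\<lambda>V x. log b (law V (V x))"
  have XYZ: "simple_function M (X \<bowtie> Y \<bowtie> Z)" and XZ: "simple_function M (X \<bowtie> Z)"
    and YZ: "simple_function M (Y \<bowtie> Z)"
    by (intro sf)+
  have i: "integrable M (?l (X \<bowtie> Y \<bowtie> Z))" "integrable M (?l (X \<bowtie> Z))"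
      "integrable M (?l (Y \<bowtie> Z))" "integrable M (?l Z)"
    using integrable_simple_comp[OF XYZ, of "\<lambda>v. log b (law (X \<bowtie> Y \<bowtie> Z) v)"]
      integrable_simple_comp[OF XZ, of "\<lambda>v. log b (law (X \<bowtie> Z) v)"]
      integrable_simple_comp[OF YZ, of "\<lambda>v. log b (law (Y \<bowtie> Z) v)"]
      integrable_simple_comp[OF Z, of "\<lambda>v. log b (law Z v)"] by auto
  have "\<I>(X ; Y | Z) = expectation (\<lambda>x. ?l (X \<bowtie> Y \<bowtie> Z) x - ?l (X \<bowtie> Z) x
      - (?l (Y \<bowtie> Z) x - ?l Z x))"
    unfolding cond_mutual_info_eq_expectation[OF assms]
  proof (rule integral_cong_AE)
    show "AE x in M. log b (law (X \<bowtie> Y \<bowtie> Z) (X x, Y x, Z x) /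
      (law (X \<bowtie> Z) (X x, Z x) * (law (Y \<bowtie> Z) (Y x, Z x) / law Z (Z x)))) =
      ?l (X \<bowtie> Y \<bowtie> Z) x - ?l (X \<bowtie> Z) x - (?l (Y \<bowtie> Z) x - ?l Z x)"
      \<comment> \<open>All four masses are positive almost everywhere, so the logarithm of the
        quotient splits.\<close>
      using AE_law_pos[OF XYZ] AE_law_pos[OF XZ] AE_law_pos[OF YZ] AE_law_pos[OF Z]
      by eventually_elim (simp add: log_divide log_mult)
    show "(\<lambda>x. log b (law (X \<bowtie> Y \<bowtie> Z) (X x, Y x, Z x) /
      (law (X \<bowtie> Z) (X x, Z x) * (law (Y \<bowtie> Z) (Y x, Z x) / law Z (Z x))))) \<in> borel_measurable M"
      using borel_measurable_integrable[OF integrable_simple_comp[OF XYZ, of "\<lambda>(x, y, z).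
        log b (law (X \<bowtie> Y \<bowtie> Z) (x, y, z) /
        (law (X \<bowtie> Z) (x, z) * (law (Y \<bowtie> Z) (y, z) / law Z z)))"]] by simp
  qed (intro borel_measurable_integrable Bochner_Integration.integrable_diff i)
  also have "\<dots> = expectation (?l (X \<bowtie> Y \<bowtie> Z)) - expectation (?l (X \<bowtie> Z))
      - (expectation (?l (Y \<bowtie> Z)) - expectation (?l Z))"
    using i by simp
  finally show ?thesis
    using XYZ XZ YZ Z by (simp add: entropy_eq_expectation)
qed

section \<open>Chain rules and the effect of independence\<close>

lemma cond_mutual_info_cong:
  assumes "simple_function M X" "simple_function M Y" "simple_function M Z"
    and "simple_function M X'" "simple_function M Y'" "simple_function M Z'"
    and "\<And>x y. X x = X y \<longleftrightarrow> X' x = X' y"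
    and "\<And>x y. Y x = Y y \<longleftrightarrow> Y' x = Y' y"
    and "\<And>x y. Z x = Z y \<longleftrightarrow> Z' x = Z' y"
  shows "\<I>(X ; Y | Z) = \<I>(X' ; Y' | Z')"
proof -
  have "\<H>(X \<bowtie> Z) = \<H>(X' \<bowtie> Z')" "\<H>(Y \<bowtie> Z) = \<H>(Y' \<bowtie> Z')"
    "\<H>(X \<bowtie> Y \<bowtie> Z) = \<H>(X' \<bowtie> Y' \<bowtie> Z')" "\<H>(Z) = \<H>(Z')"
    using assms by (intro entropy_cong_kernel simple_function_Pair; simp)+
  then show ?thesis
    using assms by (simp add: cond_mutual_info_eq_entropy)
qed

lemma cond_mutual_info_commute:
  assumes "simple_function M X" "simple_function M Y" "simple_function M Z"
  shows "\<I>(X ; Y | Z) = \<I>(Y ; X | Z)"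
proof -
  have "\<H>(X \<bowtie> Y \<bowtie> Z) = \<H>(Y \<bowtie> X \<bowtie> Z)"
    using assms by (intro entropy_cong_kernel simple_function_Pair) auto
  then show ?thesis
    using assms by (simp add: cond_mutual_info_eq_entropy)
qed

text \<open>In the four-entropy form the entropies of (B, C) and (Y, B, C) cancel on the right; only
  rebracketing is left.\<close>

lemma cond_mutual_info_chain:
  assumes "simple_function M Y" "simple_function M A" "simple_function M B" "simple_function M C"
  shows "\<I>(Y ; A \<bowtie> B | C) = \<I>(Y ; B | C) + \<I>(Y ; A | B \<bowtie> C)"
proof -
  have "\<H>((A \<bowtie> B) \<bowtie> C) = \<H>(A \<bowtie> B \<bowtie> C)"
    "\<H>(Y \<bowtie> (A \<bowtie> B) \<bowtie> C) = \<H>(Y \<bowtie> A \<bowtie> B \<bowtie> C)"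
    using assms by (intro entropy_cong_kernel simple_function_Pair; auto)+
  then show ?thesis
    using assms by (simp add: cond_mutual_info_eq_entropy simple_function_Pair)
qed

lemma cond_mutual_info_chain_commute:
  assumes "simple_function M Y" "simple_function M A" "simple_function M B" "simple_function M C"
  shows "\<I>(Y ; A \<bowtie> B | C) = \<I>(Y ; A | C) + \<I>(Y ; B | A \<bowtie> C)"
proof -
  have "\<I>(Y ; A \<bowtie> B | C) = \<I>(Y ; B \<bowtie> A | C)"
    using assms by (intro cond_mutual_info_cong simple_function_Pair) auto
  then show ?thesis
    using cond_mutual_info_chain[of Y B A C] assms by simp
qed

text \<open>
  Expand \<open>I(Y B; A | C)\<close> by the chain rule in both orders; the term \<open>I(A; B | C)\<close> vanishes.
\<close>

lemma cond_mutual_info_mono_indep: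
  assumes Y: "simple_function M Y" and A: "simple_function M A"
    and B: "simple_function M B" and C: "simple_function M C"
    and indep: "\<I>(A ; B | C) = 0"
  shows "\<I>(Y ; A | C) \<le> \<I>(Y ; A | B \<bowtie> C)"
proof -
  note [simp] = Y A B C simple_function_Pair
  have "\<I>(A ; Y | C) + \<I>(A ; B | Y \<bowtie> C) = \<I>(A ; B | C) + \<I>(A ; Y | B \<bowtie> C)"
    using cond_mutual_info_chain[of A B Y C] cond_mutual_info_chain_commute[of A B Y C] by simp
  moreover have "0 \<le> \<I>(A ; B | Y \<bowtie> C)"
    by (intro conditional_mutual_information_nonneg) simp_all
  ultimately show ?thesis
    using indep by (simp add: cond_mutual_info_commute[of Y A])
qed

text \<open>The chain rule in either order writes the zero as a sum of two nonnegative
  terms.\<close>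

lemma cond_mutual_info_pair_eq_0:
  assumes "simple_function M X" "simple_function M A" "simple_function M B" "simple_function M C"
    and "\<I>(X ; A \<bowtie> B | C) = 0"
  shows "\<I>(X ; A | C) = 0" "\<I>(X ; B | C) = 0"
    "\<I>(X ; A | B \<bowtie> C) = 0" "\<I>(X ; B | A \<bowtie> C) = 0"
proof -
  have "0 \<le> \<I>(X ; A | C)" "0 \<le> \<I>(X ; B | C)"
    "0 \<le> \<I>(X ; A | B \<bowtie> C)" "0 \<le> \<I>(X ; B | A \<bowtie> C)"
    using assms by (intro conditional_mutual_information_nonneg simple_function_Pair; simp)+
  then show "\<I>(X ; A | C) = 0" "\<I>(X ; B | C) = 0"
    "\<I>(X ; A | B \<bowtie> C) = 0" "\<I>(X ; B | A \<bowtie> C) = 0"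
    using cond_mutual_info_chain[of X A B C] cond_mutual_info_chain_commute[of X A B C] assms
    by auto
qed

section \<open>From factorising probabilities to vanishing information\<close>

text \<open>The factorisation makes the argument of the logarithm equal to 1 almost
  everywhere.\<close>

lemma cond_mutual_info_eq_0_if_cond_indep:
  assumes X: "simple_function M X" and Y: "simple_function M Y" and Z: "simple_function M Z"
    and indep: "\<And>x y z. \<P>(w in M. Z w = z) > 0 \<Longrightarrow>
      \<P>(w in M. X w = x \<and> Y w = y \<bar> Z w = z) =
      \<P>(w in M. X w = x \<bar> Z w = z) * \<P>(w in M. Y w = y \<bar> Z w = z)"
  shows "\<I>(X ; Y | Z) = 0"
proof -
  have XYZ: "simple_function M (X \<bowtie> Y \<bowtie> Z)"
    by (intro X Y Z simple_function_Pair)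
  have "AE w in M. log b (law (X \<bowtie> Y \<bowtie> Z) (X w, Y w, Z w) /
    (law (X \<bowtie> Z) (X w, Z w) * (law (Y \<bowtie> Z) (Y w, Z w) / law Z (Z w)))) = 0"
    using AE_law_pos[OF Z] AE_law_pos[OF XYZ]
  proof eventually_elim
    case (elim w)
    have law: "law Z (Z w) = \<P>(v in M. Z v = Z w)"
      "law (X \<bowtie> Z) (X w, Z w) = \<P>(v in M. X v = X w \<and> Z v = Z w)"
      "law (Y \<bowtie> Z) (Y w, Z w) = \<P>(v in M. Y v = Y w \<and> Z v = Z w)"
      "law (X \<bowtie> Y \<bowtie> Z) (X w, Y w, Z w) = \<P>(v in M. (X v = X w \<and> Y v = Y w) \<and> Z v = Z w)"
      by (auto simp: law_def intro!: arg_cong[where f=prob])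
    have eq: "law (X \<bowtie> Y \<bowtie> Z) (X w, Y w, Z w) =
      law (X \<bowtie> Z) (X w, Z w) * (law (Y \<bowtie> Z) (Y w, Z w) / law Z (Z w))"
      using indep[of "Z w" "X w" "Y w"] elim(1)
      unfolding cond_prob_def law[symmetric] by (simp add: field_simps)
    show ?case
      \<comment> \<open>The quotient has become a mass divided by itself; that mass is positive by
        \<open>elim(2)\<close>.\<close>
      unfolding eq[symmetric] using elim(2) by simp
  qed
  then have "expectation (\<lambda>w. log b (law (X \<bowtie> Y \<bowtie> Z) (X w, Y w, Z w) /
    (law (X \<bowtie> Z) (X w, Z w) * (law (Y \<bowtie> Z) (Y w, Z w) / law Z (Z w))))) = 0"
    by (rule integral_eq_zero_AE)
  then show ?thesis
    by (simp add: cond_mutual_info_eq_expectation[OF X Y Z])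
qed

lemma cond_prob_simple_sum:
  assumes "simple_function M A" and [measurable]: "Measurable.pred M P" "Measurable.pred M R"
  shows "\<P>(x in M. P x \<bar> R x) = (\<Sum>a\<in>A ` space M. \<P>(x in M. A x = a \<and> P x \<bar> R x))"
proof -
  have [measurable]: "A \<in> measurable M (count_space UNIV)"
    using assms(1) by (rule measurable_simple_function)
  have "\<P>(x in M. P x \<and> R x) = (\<Sum>a\<in>A ` space M. \<P>(x in M. (A x = a \<and> P x) \<and> R x))"
    using assms(1) by (intro prob_sum AE_I2) (auto simp: simple_functionD)
  then show ?thesis
    by (simp add: cond_prob_def sum_divide_distrib)
qed

text \<open>\<open>cond_indep4\<close> factorises only the joint law of all four variables, so the
  law of (B, C, D) given Q is recovered by summing out A.\<close>

lemma cond_indep4_imp_cond_mutual_info_eq_0: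
  assumes sf: "simple_function M A" "simple_function M B" "simple_function M C"
      "simple_function M D" "simple_function M Q"
    and indep: "cond_indep4 M A B C D Q"
  shows "\<I>(A ; B \<bowtie> C \<bowtie> D | Q) = 0"
proof (rule cond_mutual_info_eq_0_if_cond_indep)
  fix a q and bcd :: "'c \<times> 'd \<times> 'e"
  assume pos: "\<P>(w in M. Q w = q) > 0"
  obtain y c d where bcd: "bcd = (y, c, d)" by (cases bcd)
  note [measurable] = sf[THEN measurable_simple_function]
  let ?p = "\<P>(w in M. B w = y \<bar> Q w = q) * \<P>(w in M. C w = c \<bar> Q w = q) *
    \<P>(w in M. D w = d \<bar> Q w = q)"
  have joint: "\<P>(w in M. A w = a \<and> B w = y \<and> C w = c \<and> D w = d \<bar> Q w = q) =
    \<P>(w in M. A w = a \<bar> Q w = q) * ?p" for a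
    using indep pos by (simp add: cond_indep4_def mult.assoc)
  have "\<P>(w in M. B w = y \<and> C w = c \<and> D w = d \<bar> Q w = q) =
    (\<Sum>a\<in>A ` space M. \<P>(w in M. A w = a \<bar> Q w = q)) * ?p"
    by (subst cond_prob_simple_sum[OF sf(1)]) (auto simp: joint sum_distrib_right)
  \<comment> \<open>Marginalising the sure event: the conditional probabilities add up to 1 because
    the condition has positive probability.\<close>
  also have "(\<Sum>a\<in>A ` space M. \<P>(w in M. A w = a \<bar> Q w = q)) = 1"
    using cond_prob_simple_sum[OF sf(1), of "\<lambda>_. True" "\<lambda>w. Q w = q"] pos
    by (simp add: cond_prob_def)
  finally show "\<P>(w in M. A w = a \<and> (B \<bowtie> C \<bowtie> D) w = bcd \<bar> Q w = q) =
    \<P>(w in M. A w = a \<bar> Q w = q) * \<P>(w in M. (B \<bowtie> C \<bowtie> D) w = bcd \<bar> Q w = q)"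
    using joint[of a] by (simp add: bcd)
qed (intro sf simple_function_Pair)+

section \<open>The criterion for the first primary sender\<close>

text \<open>
  If \<open>R1\<close> exceeds what the secondary receiver can decode, part of it is moved to \<open>R2\<close>, leaving
  \<open>R1 = I(Yp; X1 | W Q)\<close>. Conversely the corner point \<open>S = T = 0\<close>, \<open>R1 = I(Yp; X1 | W Q)\<close>,
  \<open>R2 = I(Yp; X2 | W X1 Q)\<close> cannot be represented with a smaller \<open>R1\<close>, because its \<open>R2\<close> is
  already maximal.
\<close>

lemma region_o_subset_region_r_1_iff:
  assumes sf: "simple_function M (rvQ Z)" "simple_function M (rvU Z)" "simple_function M (rvW Z)"
      "simple_function M (rvX1 Z)" "simple_function M (rvX2 Z)"
      "simple_function M (rvYp Z)" "simple_function M (rvYs Z)"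
    and indep: "\<I>(rvX1 Z ; rvX2 Z \<bowtie> rvU Z \<bowtie> rvW Z | rvQ Z) = 0"
  shows "region_o M b Z \<subseteq> region_r M b 1 Z \<longleftrightarrow>
    \<I>(rvYp Z ; rvX1 Z | rvW Z \<bowtie> rvQ Z) \<le> \<I>(rvYs Z ; rvX1 Z | rvU Z \<bowtie> rvW Z \<bowtie> rvQ Z)"
proof -
  define Q U W X1 X2 Yp Ys where
    vars: "Q = rvQ Z" "U = rvU Z" "W = rvW Z" "X1 = rvX1 Z" "X2 = rvX2 Z" "Yp = rvYp Z" "Ys = rvYs Z"
  have sf: "simple_function M Q" "simple_function M U" "simple_function M W"
      "simple_function M X1" "simple_function M X2" "simple_function M Yp" "simple_function M Ys"
    using sf by (simp_all add: vars)
  note sfp = sf simple_function_Pair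
  note nonneg = conditional_mutual_information_nonneg

  \<comment> \<open>Regrouped so that W can be peeled off first: this yields independence of X1 from
    W given Q, and from (U, X2) given (W, Q).\<close>
  have "\<I>(X1 ; (U \<bowtie> X2) \<bowtie> W | Q) = \<I>(X1 ; X2 \<bowtie> U \<bowtie> W | Q)"
    by (intro cond_mutual_info_cong sfp) auto
  then have 0: "\<I>(X1 ; (U \<bowtie> X2) \<bowtie> W | Q) = 0"
    using indep by (simp add: vars)
  have ind_W: "\<I>(X1 ; W | Q) = 0" and "\<I>(X1 ; U \<bowtie> X2 | W \<bowtie> Q) = 0"
    using cond_mutual_info_pair_eq_0[OF _ _ _ _ 0] by (simp_all add: sfp)
  then have ind_U_W: "\<I>(X1 ; U | W \<bowtie> Q) = 0" and ind_X2_W: "\<I>(X1 ; X2 | W \<bowtie> Q) = 0"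
    using cond_mutual_info_pair_eq_0[of X1 U X2 "W \<bowtie> Q"] by (simp_all add: sfp)
  have ind_UW: "\<I>(X1 ; U \<bowtie> W | Q) = 0"
    using ind_W ind_U_W cond_mutual_info_chain[of X1 U W Q] by (simp add: sfp)
  then have ind_W_U: "\<I>(X1 ; W | U \<bowtie> Q) = 0"
    using cond_mutual_info_pair_eq_0[of X1 U W Q] by (simp add: sfp)

  \<comment> \<open>\<open>s1\<close> to \<open>s3\<close>: by independence, the secondary bounds on
    S, T and S + T only get weaker once X1 is known.\<close>
  have s1: "\<I>(Ys ; U | W \<bowtie> Q) \<le> \<I>(Ys ; U | W \<bowtie> X1 \<bowtie> Q)"
  proof -
    have "\<I>(Ys ; U | W \<bowtie> Q) \<le> \<I>(Ys ; U | X1 \<bowtie> W \<bowtie> Q)"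
      using ind_U_W by (intro cond_mutual_info_mono_indep sfp)
        (simp add: cond_mutual_info_commute[of U X1] sfp)
    also have "\<dots> = \<I>(Ys ; U | W \<bowtie> X1 \<bowtie> Q)"
      by (intro cond_mutual_info_cong sfp) auto
    finally show ?thesis .
  qed
  have s2: "\<I>(Ys ; W | U \<bowtie> Q) \<le> \<I>(Ys ; W | U \<bowtie> X1 \<bowtie> Q)"
  proof -
    have "\<I>(Ys ; W | U \<bowtie> Q) \<le> \<I>(Ys ; W | X1 \<bowtie> U \<bowtie> Q)"
      using ind_W_U by (intro cond_mutual_info_mono_indep sfp)
        (simp add: cond_mutual_info_commute[of W X1] sfp)
    also have "\<dots> = \<I>(Ys ; W | U \<bowtie> X1 \<bowtie> Q)"
      by (intro cond_mutual_info_cong sfp) auto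
    finally show ?thesis .
  qed
  have s3: "\<I>(Ys ; U \<bowtie> W | Q) \<le> \<I>(Ys ; U \<bowtie> W | X1 \<bowtie> Q)"
    using ind_UW by (intro cond_mutual_info_mono_indep sfp)
      (simp add: cond_mutual_info_commute[of "U \<bowtie> W" X1] sfp)
  \<comment> \<open>\<open>s4\<close> to \<open>s6\<close>: each bound on R1 plus S, T or both is a
    \<open>delta_o\<close> bound plus I(Ys;X1|UWQ), so it follows by adding.\<close>
  have s4: "\<I>(Ys ; U \<bowtie> X1 | W \<bowtie> Q) = \<I>(Ys ; U | W \<bowtie> Q) + \<I>(Ys ; X1 | U \<bowtie> W \<bowtie> Q)"
    by (intro cond_mutual_info_chain_commute sfp)
  have s5: "\<I>(Ys ; W \<bowtie> X1 | U \<bowtie> Q) = \<I>(Ys ; W | U \<bowtie> Q) + \<I>(Ys ; X1 | U \<bowtie> W \<bowtie> Q)"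
  proof -
    have "\<I>(Ys ; X1 | U \<bowtie> W \<bowtie> Q) = \<I>(Ys ; X1 | W \<bowtie> U \<bowtie> Q)"
      by (intro cond_mutual_info_cong sfp) auto
    then show ?thesis
      by (simp add: cond_mutual_info_chain_commute sfp)
  qed
  have s6: "\<I>(Ys ; U \<bowtie> W \<bowtie> X1 | Q) = \<I>(Ys ; U \<bowtie> W | Q) + \<I>(Ys ; X1 | U \<bowtie> W \<bowtie> Q)"
  proof -
    have "\<I>(Ys ; U \<bowtie> W \<bowtie> X1 | Q) = \<I>(Ys ; (U \<bowtie> W) \<bowtie> X1 | Q)"
      by (intro cond_mutual_info_cong sfp) auto
    also have "\<dots> = \<I>(Ys ; U \<bowtie> W | Q) + \<I>(Ys ; X1 | (U \<bowtie> W) \<bowtie> Q)"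
      by (intro cond_mutual_info_chain_commute sfp)
    also have "\<I>(Ys ; X1 | (U \<bowtie> W) \<bowtie> Q) = \<I>(Ys ; X1 | U \<bowtie> W \<bowtie> Q)"
      by (intro cond_mutual_info_cong sfp) auto
    finally show ?thesis .
  qed

  have p1: "\<I>(Yp ; X1 \<bowtie> X2 | W \<bowtie> Q) = \<I>(Yp ; X1 | W \<bowtie> Q) + \<I>(Yp ; X2 | W \<bowtie> X1 \<bowtie> Q)"
  proof -
    have "\<I>(Yp ; X2 | W \<bowtie> X1 \<bowtie> Q) = \<I>(Yp ; X2 | X1 \<bowtie> W \<bowtie> Q)"
      by (intro cond_mutual_info_cong sfp) auto
    then show ?thesis
      by (simp add: cond_mutual_info_chain_commute sfp)
  qed
  have p2: "\<I>(Yp ; W \<bowtie> X1 \<bowtie> X2 | Q) = \<I>(Yp ; X1 | Q) + \<I>(Yp ; W \<bowtie> X2 | X1 \<bowtie> Q)"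
  proof -
    have "\<I>(Yp ; W \<bowtie> X1 \<bowtie> X2 | Q) = \<I>(Yp ; X1 \<bowtie> W \<bowtie> X2 | Q)"
      by (intro cond_mutual_info_cong sfp) auto
    also have "\<dots> = \<I>(Yp ; X1 | Q) + \<I>(Yp ; W \<bowtie> X2 | X1 \<bowtie> Q)"
      by (intro cond_mutual_info_chain_commute sfp)
    finally show ?thesis .
  qed
  have p3: "\<I>(Yp ; X1 | Q) \<le> \<I>(Yp ; X1 | W \<bowtie> Q)"
    using ind_W by (intro cond_mutual_info_mono_indep sfp)
  have p4: "\<I>(Yp ; X1 | W \<bowtie> Q) \<le> \<I>(Yp ; X1 | W \<bowtie> X2 \<bowtie> Q)"
  proof -
    have "\<I>(Yp ; X1 | W \<bowtie> Q) \<le> \<I>(Yp ; X1 | X2 \<bowtie> W \<bowtie> Q)"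
      using ind_X2_W by (intro cond_mutual_info_mono_indep sfp)
    also have "\<dots> = \<I>(Yp ; X1 | W \<bowtie> X2 \<bowtie> Q)"
      by (intro cond_mutual_info_cong sfp) auto
    finally show ?thesis .
  qed
  \<comment> \<open>\<open>p5\<close> to \<open>p7\<close> are for the corner point: the leftover W
    terms are nonnegative, so with T = 0 the bounds that include T hold.\<close>
  have p5: "\<I>(Yp ; W \<bowtie> X1 | X2 \<bowtie> Q) = \<I>(Yp ; W | X2 \<bowtie> Q) + \<I>(Yp ; X1 | W \<bowtie> X2 \<bowtie> Q)"
    by (intro cond_mutual_info_chain_commute sfp)
  have p6: "\<I>(Yp ; W \<bowtie> X2 | X1 \<bowtie> Q) = \<I>(Yp ; W | X1 \<bowtie> Q) + \<I>(Yp ; X2 | W \<bowtie> X1 \<bowtie> Q)"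
    by (intro cond_mutual_info_chain_commute sfp)
  have p7: "\<I>(Yp ; W \<bowtie> X1 \<bowtie> X2 | Q) = \<I>(Yp ; W | Q) + \<I>(Yp ; X1 \<bowtie> X2 | W \<bowtie> Q)"
    by (intro cond_mutual_info_chain_commute sfp)

  note defs = rate_pairs_def delta_o_def delta_r_def primary_constraints_def
    secondary_constraints_r_def Let_def vars[symmetric]
  have "region_o M b Z \<subseteq> region_r M b 1 Z \<longleftrightarrow>
    \<I>(Yp ; X1 | W \<bowtie> Q) \<le> \<I>(Ys ; X1 | U \<bowtie> W \<bowtie> Q)"
  proof
    assume le: "\<I>(Yp ; X1 | W \<bowtie> Q) \<le> \<I>(Ys ; X1 | U \<bowtie> W \<bowtie> Q)"
    show "region_o M b Z \<subseteq> region_r M b 1 Z"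
    proof
      fix p assume "p \<in> region_o M b Z"
      then obtain R1 R2 S T where p: "p = (S + T, R1 + R2)" and o: "(R1, R2, S, T) \<in> delta_o M b Z"
        by (auto simp: region_o_def rate_pairs_def)
      define R1' where "R1' = min R1 (\<I>(Yp ; X1 | W \<bowtie> Q))"
      have "0 \<le> \<I>(Yp ; X1 | W \<bowtie> Q)"
        by (intro nonneg sfp)
      \<comment> \<open>If R1 is cut, \<open>p1\<close> turns the bound on R1 + R2 into the one on
        the enlarged second rate, and \<open>p2\<close> with \<open>p3\<close> does the same once T
        is added. The first rate only drops and the sum is unchanged.\<close>
      then have "(R1', R1 + R2 - R1', S, T) \<in> delta_r M b 1 Z"
        using o le s1 s2 s3 s4 s5 s6 p1 p2 p3 p4
        by (simp add: defs R1'_def min_def split: if_splits)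
      then show "p \<in> region_r M b 1 Z"
        using rate_pairsI unfolding p region_r_def by fastforce
    qed
  next
    assume sub: "region_o M b Z \<subseteq> region_r M b 1 Z"
    have "0 \<le> \<I>(Yp ; X1 | W \<bowtie> Q)" "0 \<le> \<I>(Yp ; X2 | W \<bowtie> X1 \<bowtie> Q)"
        "0 \<le> \<I>(Yp ; W | X1 \<bowtie> X2 \<bowtie> Q)" "0 \<le> \<I>(Yp ; W | X1 \<bowtie> Q)"
        "0 \<le> \<I>(Yp ; W | X2 \<bowtie> Q)" "0 \<le> \<I>(Yp ; W | Q)"
        "0 \<le> \<I>(Ys ; U | W \<bowtie> Q)" "0 \<le> \<I>(Ys ; W | U \<bowtie> Q)" "0 \<le> \<I>(Ys ; U \<bowtie> W | Q)"
      by (intro nonneg sfp)+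
    then have "(\<I>(Yp ; X1 | W \<bowtie> Q), \<I>(Yp ; X2 | W \<bowtie> X1 \<bowtie> Q), 0, 0) \<in> delta_o M b Z"
      using p1 p4 p5 p6 p7 by (simp add: defs)
    then have "(0 + 0, \<I>(Yp ; X1 | W \<bowtie> Q) + \<I>(Yp ; X2 | W \<bowtie> X1 \<bowtie> Q)) \<in> region_o M b Z"
      unfolding region_o_def rate_pairs_def by blast
    with sub obtain R1 R2 S T where "(R1, R2, S, T) \<in> delta_r M b 1 Z"
      and "R1 + R2 = \<I>(Yp ; X1 | W \<bowtie> Q) + \<I>(Yp ; X2 | W \<bowtie> X1 \<bowtie> Q)"
      by (force simp: region_r_def rate_pairs_def)
    then show "\<I>(Yp ; X1 | W \<bowtie> Q) \<le> \<I>(Ys ; X1 | U \<bowtie> W \<bowtie> Q)"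
      by (simp add: defs)
  qed
  then show ?thesis
    by (simp only: vars)
qed

end

section \<open>The second primary sender, by exchanging the two\<close>

text \<open>The two inputs may have different types, so the exchange maps to another record type;
  the result for the first sender is polymorphic and applies there.\<close>

definition swap_primary :: "('a, 'q, 'u, 'w, 'x1, 'x2, 'xs, 'yp, 'ys) rv_tuple
    \<Rightarrow> ('a, 'q, 'u, 'w, 'x2, 'x1, 'xs, 'yp, 'ys) rv_tuple"
  where "swap_primary Z = \<lparr>rvQ = rvQ Z, rvU = rvU Z, rvW = rvW Z, rvX1 = rvX2 Z, rvX2 = rvX1 Z,
    rvXs = rvXs Z, rvYp = rvYp Z, rvYs = rvYs Z\<rparr>"

lemma swap_primary_sel [simp]:
  "rvQ (swap_primary Z) = rvQ Z" "rvU (swap_primary Z) = rvU Z" "rvW (swap_primary Z) = rvW Z"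
  "rvX1 (swap_primary Z) = rvX2 Z" "rvX2 (swap_primary Z) = rvX1 Z"
  "rvYp (swap_primary Z) = rvYp Z" "rvYs (swap_primary Z) = rvYs Z"
  by (simp_all add: swap_primary_def)

context information_space
begin

text \<open>Four of the seven bounds are permuted in pairs as they stand; the other three contain X1
  and X2 together and need only a reordering.\<close>

lemma primary_constraints_swap:
  assumes sf: "simple_function M (rvQ Z)" "simple_function M (rvW Z)"
      "simple_function M (rvX1 Z)" "simple_function M (rvX2 Z)" "simple_function M (rvYp Z)"
  shows "primary_constraints M b (swap_primary Z) R2 R1 T \<longleftrightarrow> primary_constraints M b Z R1 R2 T"
proof -
  note sfp = sf simple_function_Pair
  have "\<I>(rvYp Z ; rvW Z | rvX2 Z \<bowtie> rvX1 Z \<bowtie> rvQ Z) = \<I>(rvYp Z ; rvW Z | rvX1 Z \<bowtie> rvX2 Z \<bowtie> rvQ Z)"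
    "\<I>(rvYp Z ; rvX2 Z \<bowtie> rvX1 Z | rvW Z \<bowtie> rvQ Z) = \<I>(rvYp Z ; rvX1 Z \<bowtie> rvX2 Z | rvW Z \<bowtie> rvQ Z)"
    "\<I>(rvYp Z ; rvW Z \<bowtie> rvX2 Z \<bowtie> rvX1 Z | rvQ Z) = \<I>(rvYp Z ; rvW Z \<bowtie> rvX1 Z \<bowtie> rvX2 Z | rvQ Z)"
    by (intro cond_mutual_info_cong sfp; auto)+
  then show ?thesis
    by (auto simp: primary_constraints_def Let_def add.commute)
qed

text \<open>The exchange swaps R1 and R2, and the projection sees only their sum.\<close>

lemma region_swap:
  assumes "simple_function M (rvQ Z)" "simple_function M (rvW Z)"
      "simple_function M (rvX1 Z)" "simple_function M (rvX2 Z)" "simple_function M (rvYp Z)"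
  shows "region_o M b (swap_primary Z) = region_o M b Z"
    and "region_r M b 1 (swap_primary Z) = region_r M b 2 Z"
proof -
  have o: "(R2, R1, S, T) \<in> delta_o M b (swap_primary Z) \<longleftrightarrow> (R1, R2, S, T) \<in> delta_o M b Z"
    for R1 R2 S T
    using primary_constraints_swap[OF assms] by (auto simp: delta_o_def)
  have r: "(R2, R1, S, T) \<in> delta_r M b 1 (swap_primary Z) \<longleftrightarrow> (R1, R2, S, T) \<in> delta_r M b 2 Z"
    for R1 R2 S T
    using primary_constraints_swap[OF assms]
    by (auto simp: delta_r_def secondary_constraints_r_def)
  have swap: "rate_pairs D' = rate_pairs D"
    if "\<And>R1 R2 S T. (R2, R1, S, T) \<in> D' \<longleftrightarrow> (R1, R2, S, T) \<in> D" for D D'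
    using that by (intro equalityI rate_pairs_swap_mono) auto
  show "region_o M b (swap_primary Z) = region_o M b Z"
    unfolding region_o_def by (rule swap) (rule o)
  show "region_r M b 1 (swap_primary Z) = region_r M b 2 Z"
    unfolding region_r_def by (rule swap) (rule r)
qed

end

theorem theorem5:
  fixes M :: "'a measure" and b :: real and i :: nat
    and \<X>1 :: "'x1 set" and \<X>2 :: "'x2 set" and \<X>s :: "'xs set"
    and \<Y>p :: "'yp set" and \<Y>s :: "'ys set"
    and \<omega> :: "'x1 \<Rightarrow> 'x2 \<Rightarrow> 'xs \<Rightarrow> ('yp \<times> 'ys) pmf"
    and Z :: "('a, 'q, 'u, 'w, 'x1, 'x2, 'xs, 'yp, 'ys) rv_tuple"
  assumes "information_space M b"
    and "finite \<X>1" "finite \<X>2" "finite \<X>s" "finite \<Y>p" "finite \<Y>s"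
    and "channel \<X>1 \<X>2 \<X>s \<Y>p \<Y>s \<omega>"
    and "Z \<in> Pstar M \<X>1 \<X>2 \<X>s \<Y>p \<Y>s \<omega>"
    and "i \<in> {1, 2}"
  shows "region_o M b Z \<subseteq> region_r M b i Z \<longleftrightarrow>
    (if i = 1
     then cmi M b (rvYp Z) (rvX1 Z) (rvW Z \<bowtie> rvQ Z)
            \<le> cmi M b (rvYs Z) (rvX1 Z) (rvU Z \<bowtie> rvW Z \<bowtie> rvQ Z)
     else cmi M b (rvYp Z) (rvX2 Z) (rvW Z \<bowtie> rvQ Z)
            \<le> cmi M b (rvYs Z) (rvX2 Z) (rvU Z \<bowtie> rvW Z \<bowtie> rvQ Z))"
proof -
  interpret information_space M b by fact
  have sf: "simple_function M (rvQ Z)" "simple_function M (rvU Z)" "simple_function M (rvW Z)"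
      "simple_function M (rvX1 Z)" "simple_function M (rvX2 Z)"
      "simple_function M (rvYp Z)" "simple_function M (rvYs Z)"
    and indep: "cond_indep4 M (rvX1 Z) (rvX2 Z) (rvU Z) (rvW Z) (rvQ Z)"
    using assms(8) by (auto simp: Pstar_def)
  \<comment> \<open>A list of two facts: the equivalence keeps its independence premise, which the
    second fact discharges during simplification.\<close>
  note iff1 = region_o_subset_region_r_1_iff[OF sf]
    cond_indep4_imp_cond_mutual_info_eq_0[OF sf(4,5,2,3,1) indep]
  \<comment> \<open>The first-sender criterion for the exchanged tuple, translated back by
    \<open>region_swap\<close>.\<close>
  have iff2: "region_o M b Z \<subseteq> region_r M b 2 Z \<longleftrightarrow>
    \<I>(rvYp Z ; rvX2 Z | rvW Z \<bowtie> rvQ Z) \<le> \<I>(rvYs Z ; rvX2 Z | rvU Z \<bowtie> rvW Z \<bowtie> rvQ Z)"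
    using region_o_subset_region_r_1_iff[of "swap_primary Z"] sf region_swap[of Z]
      cond_indep4_imp_cond_mutual_info_eq_0[OF sf(5,4,2,3,1) cond_indep4_swap[OF indep]] by simp
  show ?thesis
    using assms(9) iff1 iff2 by auto
qed

end
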